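(* Let $k\ge 1$ be an integer, let $X_k=Y_k=[0,\infty)\times\{0,\ldots,k\}\subseteq\mathbb{R}^2$, and let $f_k\colon X_k\to X_k$ and $g_k\colon Y_k\to Y_k$ be the bijective maps $$g_k(r,j)=\bigl(2^{\min(j,1)}r,\ (j-1)\bmod (k+1)\bigr),$$ $$f_k(r,j)=\begin{cases}\bigl(2^{\min(j,1)}r,\ (j-1)\bmod k\bigr)&\text{if } j\le k-1,\\ (2r,\ j)&\text{if } j=k.\end{cases}$$ Then, for every integer $n>k$, there is no coarse equivalence $\varphi\colon X_k\to Y_k$ such that $\varphi\circ f_k^n$ and $g_k^n\circ\varphi$ are close; in particular, $f_k^n$ and $g_k^n$ are not coarsely conjugate.
   Context: Subsets of $\mathbb{R}^2$ carry the metric induced by a norm (the choice is irrelevant; e.g. the maximum norm). For integers $a$ and $m\ge1$, $a\bmod m$ is the residue in $\{0,\ldots,m-1\}$. $f^n$ denotes the $n$-fold iterate. Let $(X,d_X)$ and $(Y,d_Y)$ be metric spaces. Two maps $a,b$ from a set $S$ to $Y$ are close if $\sup_{x\in S} d_Y(a(x),b(x))<\infty$. A map $\varphi\colon X\to Y$ is controlled if there exists a non-decreasing function $\rho\colon[0,\infty)\to[0,\infty)$ such that $d_Y(\varphi(x),\varphi(x'))\le\rho(d_X(x,x'))$ for all $x,x'\in X$. A controlled map $\varphi\colon X\to Y$ is a coarse equivalence if it admits a coarse inverse, that is, a controlled map $\psi\colon Y\to X$ such that $\varphi\circ\psi$ and $\psi\circ\varphi$ are close to the respective identity maps. Maps $f\colon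 X\to X$ and $g\colon Y\to Y$ are coarsely conjugate if there exists a coarse equivalence $\varphi\colon X\to Y$ with a coarse inverse $\psi\colon Y\to X$ such that $\varphi\circ f$ is close to $g\circ\varphi$ and $\psi\circ g$ is close to $f\circ\psi$. *)

theory Defs
  imports "HOL-Analysis.Analysis"
begin

definition close_maps :: "'s set \<Rightarrow> 'b metric \<Rightarrow> ('s \<Rightarrow> 'b) \<Rightarrow> ('s \<Rightarrow> 'b) \<Rightarrow> bool" where
  "close_maps S Y a b \<longleftrightarrow>
     a \<in> S \<rightarrow> mspace Y \<and> b \<in> S \<rightarrow> mspace Y \<and>
     bdd_above ((\<lambda>x. mdist Y (a x) (b x)) ` S)"

definition controlled :: "'a metric \<Rightarrow> 'b metric \<Rightarrow> ('a \<Rightarrow> 'b) \<Rightarrow> bool" where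
  "controlled X Y \<phi> \<longleftrightarrow>
     \<phi> \<in> mspace X \<rightarrow> mspace Y \<and>
     (\<exists>\<rho>::real \<Rightarrow> real. \<rho> \<in> {0..} \<rightarrow> {0..} \<and> mono_on {0..} \<rho> \<and>
        (\<forall>x\<in>mspace X. \<forall>x'\<in>mspace X. mdist Y (\<phi> x) (\<phi> x') \<le> \<rho> (mdist X x x')))"

definition coarse_inverse ::
    "'a metric \<Rightarrow> 'b metric \<Rightarrow> ('a \<Rightarrow> 'b) \<Rightarrow> ('b \<Rightarrow> 'a) \<Rightarrow> bool" where
  "coarse_inverse X Y \<phi> \<psi> \<longleftrightarrow>
     controlled Y X \<psi> \<and>
     close_maps (mspace Y) Y (\<phi> \<circ> \<psi>) id \<and>
     close_maps (mspace X) X (\<psi> \<circ> \<phi>) id"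

definition coarse_equivalence :: "'a metric \<Rightarrow> 'b metric \<Rightarrow> ('a \<Rightarrow> 'b) \<Rightarrow> bool" where
  "coarse_equivalence X Y \<phi> \<longleftrightarrow>
     controlled X Y \<phi> \<and> (\<exists>\<psi>. coarse_inverse X Y \<phi> \<psi>)"

definition coarsely_conjugate ::
    "'a metric \<Rightarrow> 'b metric \<Rightarrow> ('a \<Rightarrow> 'a) \<Rightarrow> ('b \<Rightarrow> 'b) \<Rightarrow> bool" where
  "coarsely_conjugate X Y f g \<longleftrightarrow>
     (\<exists>\<phi> \<psi>. coarse_equivalence X Y \<phi> \<and> coarse_inverse X Y \<phi> \<psi> \<and>
        close_maps (mspace X) Y (\<phi> \<circ> f) (g \<circ> \<phi>) \<and>
        close_maps (mspace Y) X (\<psi> \<circ> g) (f \<circ> \<psi>))"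

definition is_norm :: "('a::real_vector \<Rightarrow> real) \<Rightarrow> bool" where
  "is_norm N \<longleftrightarrow>
     (\<forall>x. N x = 0 \<longleftrightarrow> x = 0) \<and>
     (\<forall>c x. N (c *\<^sub>R x) = \<bar>c\<bar> * N x) \<and>
     (\<forall>x y. N (x + y) \<le> N x + N y)"

definition norm_metric :: "('a::real_vector \<Rightarrow> real) \<Rightarrow> 'a set \<Rightarrow> 'a metric" where
  "norm_metric N S = metric (S, \<lambda>x y. N (x - y))"

lemma is_norm_Metric_space:
  assumes "is_norm N"
  shows "Metric_space S (\<lambda>x y. N (x - y))"
proof -
  have zero: "N x = 0 \<longleftrightarrow> x = 0" and scale: "N (c *\<^sub>R x) = \<bar>c\<bar> * N x"
    and tri: "N (x + y) \<le> N x + N y" for x y c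
    using assms by (auto simp: is_norm_def)
  have minus: "N (- x) = N x" for x
    using scale[of "-1" x] by simp
  have nonneg: "0 \<le> N x" for x
    using tri[of x "- x"] zero[of 0] minus[of x] by simp
  show ?thesis
  proof
    show "0 \<le> N (x - y)" for x y by (rule nonneg)
    show "N (x - y) = N (y - x)" for x y using minus[of "x - y"] by simp
    show "N (x - y) = 0 \<longleftrightarrow> x = y" for x y using zero[of "x - y"] by simp
    show "N (x - z) \<le> N (x - y) + N (y - z)" for x y z
      using tri[of "x - y" "y - z"] by simp
  qed
qed

text \<open>The following two lemmas confirm that \<^const>\<open>norm_metric\<close> is not the unspecified
  value that \<^const>\<open>metric\<close> takes on pairs that are not metric spaces.\<close>

lemma mspace_norm_metric [simp]: "is_norm N \<Longrightarrow> mspace (norm_metric N S) = S"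
  by (simp add: norm_metric_def Metric_space.mspace_metric is_norm_Metric_space)

lemma mdist_norm_metric [simp]: "is_norm N \<Longrightarrow> mdist (norm_metric N S) x y = N (x - y)"
  by (simp add: norm_metric_def Metric_space.mdist_metric is_norm_Metric_space)

lemma is_norm_norm: "is_norm (norm :: 'a::real_normed_vector \<Rightarrow> real)"
  by (simp add: is_norm_def norm_triangle_ineq)

definition rays :: "nat \<Rightarrow> (real \<times> real) set" where
  "rays k = {0..} \<times> real ` {0..k}"

text \<open>Points of \<^term>\<open>rays k\<close> have a real second coordinate with an integer value; the
  floor recovers the integer \<open>j\<close>. Outside \<^term>\<open>rays k\<close> the values of the maps are irrelevant.\<close>

definition g_map :: "nat \<Rightarrow> real \<times> real \<Rightarrow> real \<times> real" where
  "g_map k = (\<lambda>(r, y). let j = \<lfloor>y\<rfloor> in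
     (2 powi (min j 1) * r, of_int ((j - 1) mod (int k + 1))))"

definition f_map :: "nat \<Rightarrow> real \<times> real \<Rightarrow> real \<times> real" where
  "f_map k = (\<lambda>(r, y). let j = \<lfloor>y\<rfloor> in
     if j \<le> int k - 1 then (2 powi (min j 1) * r, of_int ((j - 1) mod int k))
     else (2 * r, of_int j))"

end

theory Submission
  imports Defs
begin

text \<open>All rays lie at bounded distance from each other, so on a large scale only the radius
  matters. A controlled map between such spaces grows at most linearly in the radius
  (\<open>controlled_linear_growth\<close>); applied to a coarse inverse, this shows that a coarse equivalence
  \<open>\<phi>\<close> satisfies \<open>r \<le> A h(r) + B\<close>, where \<open>h(r)\<close> is the radius of \<open>\<phi>(r, k)\<close>.
  Now \<open>f\<^sub>k\<^sup>n\<close> multiplies the radius on the ray \<open>k\<close> by \<open>2\<^sup>n\<close>. Under \<open>g\<^sub>k\<close>, however, every orbit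
  visits the ray \<open>0\<close> within its first \<open>k + 1\<close> points, and leaving it does not change the radius.
  Hence, if \<open>n > k\<close>, at least one of the \<open>n\<close> doublings is lost and \<open>g\<^sub>k\<^sup>n\<close> multiplies the
  radius by at most \<open>2\<^sup>n\<^sup>-\<^sup>1\<close> everywhere (\<open>fst_g_map_funpow_le\<close>).
  If \<open>\<phi> \<circ> f\<^sub>k\<^sup>n\<close> and \<open>g\<^sub>k\<^sup>n \<circ> \<phi>\<close> were close, then \<open>h(2\<^sup>n r) \<le> 2\<^sup>n\<^sup>-\<^sup>1 h(r) + D\<close>, so
  along \<open>r = 2\<^sup>n\<^sup>m\<close> the function \<open>h\<close> would grow slower than linearly, contradicting the
  lower bound (\<open>no_linear_lower_bound\<close>).\<close>

section \<open>The two maps on the rays\<close>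

lemma raysE:
  assumes "p \<in> rays k"
  obtains r j where "p = (r, real j)" "0 \<le> r" "j \<le> k"
  using assms by (auto simp: rays_def)

lemma raysI: "0 \<le> r \<Longrightarrow> j \<le> k \<Longrightarrow> (r, real j) \<in> rays k"
  by (auto simp: rays_def)

lemma raysI_pred:
  assumes "0 \<le> r" "0 < j" "j \<le> k"
  shows "(r, real j - 1) \<in> rays k"
  using assms raysI[of r "j - 1" k] by (simp add: of_nat_diff)

lemma g_map_ray:
  assumes "j \<le> k"
  shows "g_map k (r, real j) = (if j = 0 then (r, real k) else (2 * r, real (j - 1)))"
  using assms by (cases j) (auto simp: g_map_def Let_def zmod_minus1 min_def)

lemma f_map_ray:
  assumes "j < k"
  shows "f_map k (r, real j) = (if j = 0 then (r, real (k - 1)) else (2 * r, real (j - 1)))"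
  using assms by (cases j) (auto simp: f_map_def Let_def zmod_minus1 of_nat_diff min_def)

lemma f_map_last_ray: "f_map k (r, real k) = (2 * r, real k)"
  by (simp add: f_map_def)

section \<open>Bijectivity\<close>

lemma bij_betw_g_map: "bij_betw (g_map k) (rays k) (rays k)"
proof (rule bij_betw_byWitness)
  let ?inv = "\<lambda>(r, y). if y = real k then (r, 0) else (r / 2, y + 1)"
  show "\<forall>p\<in>rays k. ?inv (g_map k p) = p"
    by (auto elim!: raysE simp: g_map_ray of_nat_diff)
  show "\<forall>p\<in>rays k. g_map k (?inv p) = p"
  proof
    fix p assume "p \<in> rays k"
    then obtain r j where p: "p = (r, real j)" "j \<le> k" by (rule raysE)
    show "g_map k (?inv p) = p"
      using p g_map_ray[of 0 k r] g_map_ray[of "Suc j" k "r / 2"] by (auto simp: add.commute)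
  qed
  show "g_map k ` rays k \<subseteq> rays k"
    by (auto elim!: raysE simp: g_map_ray of_nat_diff intro!: raysI raysI_pred)
  show "?inv ` rays k \<subseteq> rays k"
  proof
    fix q assume "q \<in> ?inv ` rays k"
    then obtain r j where q: "q = ?inv (r, real j)" "0 \<le> r" "j \<le> k" by (auto elim!: raysE)
    then show "q \<in> rays k"
      using raysI[of r 0 k] raysI[of "r / 2" "Suc j" k] by (auto simp: add.commute)
  qed
qed

lemma bij_betw_f_map:
  assumes "k \<ge> 1"
  shows "bij_betw (f_map k) (rays k) (rays k)"
proof (rule bij_betw_byWitness)
  let ?inv = "\<lambda>(r, y). if y = real k then (r / 2, y)
                        else if y = real (k - 1) then (r, 0) else (r / 2, y + 1)"
  have f_ray: "f_map k (r, real j) =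
      (if j = k then (2 * r, real k) else if j = 0 then (r, real (k - 1)) else (2 * r, real (j - 1)))"
    if "j \<le> k" for r j
    using that f_map_ray[of j k r] f_map_last_ray[of k r] by auto
  show "\<forall>p\<in>rays k. ?inv (f_map k p) = p"
    using assms by (auto elim!: raysE simp: f_ray of_nat_diff)
  show "\<forall>p\<in>rays k. f_map k (?inv p) = p"
  proof
    fix p assume "p \<in> rays k"
    then obtain r j where p: "p = (r, real j)" "j \<le> k" by (rule raysE)
    then consider "j = k" | "j = k - 1" "j < k" | "Suc j < k" by linarith
    then show "f_map k (?inv p) = p"
      using p f_ray[of 0 r] f_ray[of k "r / 2"] f_ray[of "Suc j" "r / 2"] assms
      by cases (auto simp: add.commute)
  qed
  show "f_map k ` rays k \<subseteq> rays k"
    using assms by (auto elim!: raysE simp: f_ray of_nat_diff intro!: raysI raysI_pred)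
  show "?inv ` rays k \<subseteq> rays k"
  proof
    fix q assume "q \<in> ?inv ` rays k"
    then obtain r j where q: "q = ?inv (r, real j)" "0 \<le> r" "j \<le> k" by (auto elim!: raysE)
    then consider "j = k" | "j = k - 1" "j < k" | "Suc j < k" by linarith
    then show "q \<in> rays k"
      using q raysI[of r 0 k] raysI[of "r / 2" k k] raysI[of "r / 2" "Suc j" k]
      by cases (auto simp: add.commute)
  qed
qed

section \<open>Growth of the radius under iteration\<close>

lemma g_map_funpow_in_rays: "p \<in> rays k \<Longrightarrow> (g_map k ^^ n) p \<in> rays k"
  by (induction n) (auto intro: bij_betw_apply[OF bij_betw_g_map])

lemma fst_g_map_funpow_le_pow2:
  assumes "p \<in> rays k"
  shows "fst ((g_map k ^^ n) p) \<le> 2 ^ n * fst p"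
proof (induction n)
  case (Suc n)
  have "fst (g_map k q) \<le> 2 * fst q" if "q \<in> rays k" for q
    using that by (auto elim!: raysE simp: g_map_ray)
  from this[OF g_map_funpow_in_rays[OF assms, of n]] Suc show ?case
    by simp
qed simp

lemma g_map_funpow_descend:
  "i \<le> j \<Longrightarrow> j \<le> k \<Longrightarrow> (g_map k ^^ i) (r, real j) = (2 ^ i * r, real (j - i))"
proof (induction i)
  case (Suc i)
  then have "(g_map k ^^ Suc i) (r, real j) = g_map k (2 ^ i * r, real (j - i))" by simp
  also have "\<dots> = (2 ^ Suc i * r, real (j - Suc i))"
    using Suc.prems by (subst g_map_ray) auto
  finally show ?case .
qed simp

text \<open>The orbit of a point of the ray \<open>j\<close> reaches the ray \<open>0\<close> after \<open>j < n\<close> steps, and the step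
  that follows is not a doubling.\<close>

lemma fst_g_map_funpow_le:
  assumes "p \<in> rays k" "k < n"
  shows "fst ((g_map k ^^ n) p) \<le> 2 ^ (n - 1) * fst p"
proof -
  obtain r j where p: "p = (r, real j)" "0 \<le> r" "j \<le> k" using assms(1) by (rule raysE)
  define m where "m = n - Suc j"
  have n: "n = m + Suc j" using p assms(2) by (simp add: m_def)
  have "(g_map k ^^ Suc j) p = (2 ^ j * r, real k)"
    using p g_map_funpow_descend[of j j k r] g_map_ray[of 0 k] by simp
  then have "fst ((g_map k ^^ n) p) = fst ((g_map k ^^ m) (2 ^ j * r, real k))"
    unfolding n funpow_add by simp
  also have "\<dots> \<le> 2 ^ m * (2 ^ j * r)"
    using fst_g_map_funpow_le_pow2[of "(2 ^ j * r, real k)" k m] p by (simp add: raysI)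
  also have "\<dots> = 2 ^ (n - 1) * fst p"
    by (simp add: n p power_add)
  finally show ?thesis .
qed

lemma f_map_funpow_last_ray: "(f_map k ^^ n) (r, real k) = (2 ^ n * r, real k)"
  by (induction n) (simp_all add: f_map_last_ray)

section \<open>Norms and radii\<close>

lemma is_norm_nonneg:
  assumes "is_norm N"
  shows "0 \<le> N x"
  using Metric_space.nonneg[OF is_norm_Metric_space[OF assms], of x 0] by simp

lemma is_norm_scale: "is_norm N \<Longrightarrow> N (c *\<^sub>R x) = \<bar>c\<bar> * N x"
  by (simp add: is_norm_def)

lemma is_norm_triangle: "is_norm N \<Longrightarrow> N (x + y) \<le> N x + N y"
  by (simp add: is_norm_def)

lemma is_norm_minus_commute: "is_norm N \<Longrightarrow> N (x - y) = N (y - x)"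
  using is_norm_scale[of N "-1" "x - y"] by simp

lemma is_norm_triangle_diff: "is_norm N \<Longrightarrow> N x \<le> N y + N (x - y)"
  using is_norm_triangle[of N y "x - y"] by simp

text \<open>On the rays the norm is the radius, up to the factor \<open>N (1, 0)\<close> and an additive constant
  bounding the width of the strip that contains the rays.\<close>

lemma norm_on_rays:
  assumes N: "is_norm N" and p: "p \<in> rays k"
  shows norm_on_rays_le: "N p \<le> fst p * N (1, 0) + real k * N (0, 1)"
    and norm_on_rays_ge: "fst p * N (1, 0) \<le> N p + real k * N (0, 1)"
proof -
  obtain r j where p: "p = (r, real j)" "0 \<le> r" "j \<le> k" using p by (rule raysE)
  have radial: "N (r, 0) = r * N (1, 0)" and across: "N (0, real j) = real j * N (0, 1)"
    using is_norm_scale[OF N, of r "(1, 0)"] is_norm_scale[OF N, of "real j" "(0, 1)"] p(2)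
    by simp_all
  have width: "N (0, real j) \<le> real k * N (0, 1)"
    unfolding across using p(3) is_norm_nonneg[OF N] by (intro mult_right_mono) auto
  show "N p \<le> fst p * N (1, 0) + real k * N (0, 1)"
    using is_norm_triangle[OF N, of "(r, 0)" "(0, real j)"] radial width by (simp add: p(1))
  show "fst p * N (1, 0) \<le> N p + real k * N (0, 1)"
    using is_norm_triangle_diff[OF N, of "(r, 0)" "p"] radial width
      is_norm_minus_commute[OF N, of p "(r, 0)"] by (simp add: p(1))
qed

section \<open>Linear growth of controlled maps\<close>

text \<open>Moving along a ray in steps of length at most \<open>1\<close> towards the origin changes the value of a
  controlled map by a bounded amount per step.\<close>

lemma controlled_linear_growth:
  assumes N: "is_norm N" and N': "is_norm N'"
    and ctrl: "controlled (norm_metric N (rays k)) (norm_metric N' S) \<psi>"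
  obtains A B where "0 \<le> A" "\<And>p. p \<in> rays k \<Longrightarrow> N' (\<psi> p) \<le> A * fst p + B"
proof -
  obtain \<rho> :: "real \<Rightarrow> real" where \<rho>: "\<rho> \<in> {0..} \<rightarrow> {0..}" "mono_on {0..} \<rho>"
    and le_\<rho>: "\<And>x y. x \<in> rays k \<Longrightarrow> y \<in> rays k \<Longrightarrow> N' (\<psi> x - \<psi> y) \<le> \<rho> (N (x - y))"
    using ctrl N N' unfolding controlled_def by (simp del: split_paired_All) blast
  have change: "N' (\<psi> x) \<le> N' (\<psi> y) + \<rho> t" if "x \<in> rays k" "y \<in> rays k" "N (x - y) \<le> t" for x y t
  proof -
    have "\<rho> (N (x - y)) \<le> \<rho> t"
      using mono_onD[OF \<rho>(2)] that(3) is_norm_nonneg[OF N, of "x - y"] by force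
    then show ?thesis
      using is_norm_triangle_diff[OF N', of "\<psi> x" "\<psi> y"] le_\<rho>[OF that(1,2)] by linarith
  qed
  define A where "A = \<rho> (N (1, 0))"
  define B where "B = N' (\<psi> (0, 0)) + \<rho> (real k * N (0, 1))"
  have A: "0 \<le> A" using \<rho>(1) is_norm_nonneg[OF N] by (auto simp: A_def)
  have steps: "N' (\<psi> (r, real j)) \<le> A * real m + B"
    if "j \<le> k" "0 \<le> r" "r \<le> real m" for r j m
    using that(2,3)
  proof (induction m arbitrary: r)
    case 0
    have "(0, real j) \<in> rays k" "(0, 0) \<in> rays k"
      using raysI[of 0 j k] raysI[of 0 0 k] that(1) by simp_all
    moreover from norm_on_rays_le[OF N this(1)] have "N ((0, real j) - (0, 0)) \<le> real k * N (0, 1)"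
      by simp
    ultimately show ?case using change 0 by (simp add: B_def)
  next
    case (Suc m)
    define s where "s = max 0 (r - 1)"
    have s: "0 \<le> s" "s \<le> real m" "\<bar>r - s\<bar> \<le> 1" using Suc.prems by (auto simp: s_def)
    have "N ((r, real j) - (s, real j)) = \<bar>r - s\<bar> * N (1, 0)"
      using is_norm_scale[OF N, of "r - s" "(1, 0)"] by simp
    also have "\<dots> \<le> N (1, 0)"
      using mult_right_mono[OF s(3) is_norm_nonneg[OF N, of "(1, 0)"]] by simp
    finally have "N' (\<psi> (r, real j)) \<le> N' (\<psi> (s, real j)) + A"
      unfolding A_def using change Suc.prems s that(1) raysI by blast
    with Suc.IH[OF s(1,2)] show ?case by (simp add: algebra_simps)
  qed
  \<comment> \<open>Rounding the radius up to an integer costs one more step.\<close>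
  have "N' (\<psi> p) \<le> A * fst p + (A + B)" if p_in: "p \<in> rays k" for p
  proof -
    obtain r j where p: "p = (r, real j)" "0 \<le> r" "j \<le> k" using p_in by (rule raysE)
    have "N' (\<psi> p) \<le> A * real (nat \<lceil>r\<rceil>) + B"
      using steps[of j r "nat \<lceil>r\<rceil>"] p by (simp add: real_nat_ceiling_ge)
    also have "\<dots> \<le> A * (r + 1) + B"
      using A p(2) by (intro add_right_mono mult_left_mono) linarith+
    finally show ?thesis by (simp add: p(1) algebra_simps)
  qed
  with A show ?thesis by (rule that)
qed

section \<open>The contradiction\<close>

text \<open>The step inequality gives \<open>h((2q)\<^sup>m) = O(q\<^sup>m)\<close>, whereas the lower bound would require growth
  of order \<open>(2q)\<^sup>m\<close>. With \<open>q \<ge> 2\<close>, the additive error is absorbed by considering \<open>h + D\<close>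
  in place of \<open>h\<close>.\<close>

lemma no_linear_lower_bound:
  fixes h :: "real \<Rightarrow> real"
  assumes q: "2 \<le> q" and D: "0 \<le> D" and A: "0 \<le> A"
    and step: "\<And>r. 0 \<le> r \<Longrightarrow> h (2 * q * r) \<le> q * h r + D"
    and lower: "\<And>r. 0 \<le> r \<Longrightarrow> r \<le> A * h r + B"
  shows False
proof -
  have upper: "h ((2 * q) ^ m) + D \<le> q ^ m * (h 1 + D)" for m
  proof (induction m)
    case (Suc m)
    have "h ((2 * q) ^ Suc m) + D \<le> q * h ((2 * q) ^ m) + 2 * D"
      using step[of "(2 * q) ^ m"] q by simp
    also have "\<dots> \<le> q * (h ((2 * q) ^ m) + D)"
      using mult_right_mono[OF q D] by (simp add: algebra_simps)
    also have "\<dots> \<le> q * (q ^ m * (h 1 + D))"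
      using Suc q by (intro mult_left_mono) auto
    finally show ?case by (simp add: mult.assoc)
  qed simp
  have bounded: "2 ^ m \<le> A * (h 1 + D) + \<bar>B\<bar>" for m
  proof -
    have qm: "1 \<le> q ^ m" using q by simp
    have "q ^ m * 2 ^ m \<le> A * h ((2 * q) ^ m) + B"
      using lower[of "(2 * q) ^ m"] q by (simp add: power_mult_distrib mult.commute)
    also have "\<dots> \<le> A * (q ^ m * (h 1 + D)) + q ^ m * \<bar>B\<bar>"
    proof (rule add_mono)
      show "A * h ((2 * q) ^ m) \<le> A * (q ^ m * (h 1 + D))"
        using upper[of m] D A by (intro mult_left_mono) auto
      show "B \<le> q ^ m * \<bar>B\<bar>"
        using mult_right_mono[OF qm, of "\<bar>B\<bar>"] by simp
    qed
    also have "\<dots> = q ^ m * (A * (h 1 + D) + \<bar>B\<bar>)" by (simp add: algebra_simps)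
    finally show ?thesis using qm by simp
  qed
  obtain m where "A * (h 1 + D) + \<bar>B\<bar> < 2 ^ m" using real_arch_pow[of 2] by auto
  with bounded[of m] show False by simp
qed

text \<open>The ray \<open>k\<close>, which \<open>f\<^sub>k\<close> maps to itself with factor \<open>2\<close>, is the only part of the domain
  on which the two maps need to be compared.\<close>

lemma no_coarse_equivalence:
  assumes N: "is_norm N" and k: "k \<ge> 1" and n: "k < n"
    and X: "X = norm_metric N (rays k)"
    and equiv: "coarse_equivalence X X \<phi>"
    and close: "close_maps (mspace X) X (\<phi> \<circ> (f_map k ^^ n)) ((g_map k ^^ n) \<circ> \<phi>)"
  shows False
proof -
  define e where "e = N (1, 0)"
  define w where "w = real k * N (0, 1)"
  have e: "0 < e" using N is_norm_nonneg[OF N, of "(1, 0)"]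
    by (auto simp: e_def is_norm_def zero_prod_def order_less_le)
  have w: "0 \<le> w" using is_norm_nonneg[OF N] by (simp add: w_def)
  note le = norm_on_rays_le[OF N, where k = k, folded e_def w_def]
    and ge = norm_on_rays_ge[OF N, where k = k, folded e_def w_def]
  have \<phi>: "\<phi> x \<in> rays k" if "x \<in> rays k" for x
    using equiv that N by (auto simp: coarse_equivalence_def controlled_def X)
  obtain \<psi> where ctrl: "controlled X X \<psi>" and inv: "close_maps (mspace X) X (\<psi> \<circ> \<phi>) id"
    using equiv by (auto simp: coarse_equivalence_def coarse_inverse_def)
  obtain C where C: "\<And>x. x \<in> rays k \<Longrightarrow> N (\<psi> (\<phi> x) - x) \<le> C"
    using inv N by (auto simp: close_maps_def X bdd_above_def)
  obtain D where D: "\<And>x. x \<in> rays k \<Longrightarrow> N (\<phi> ((f_map k ^^ n) x) - (g_map k ^^ n) (\<phi> x)) \<le> D"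
    using close N by (auto simp: close_maps_def X bdd_above_def)
  obtain A B where A: "0 \<le> A" and AB: "\<And>p. p \<in> rays k \<Longrightarrow> N (\<psi> p) \<le> A * fst p + B"
    using controlled_linear_growth[OF N N ctrl[unfolded X]] by blast
  define h where "h r = fst (\<phi> (r, real k))" for r
  have ray: "(r, real k) \<in> rays k" if "0 \<le> r" for r using that by (simp add: raysI)
  have lower: "r \<le> (A / e) * h r + (B + C + w) / e" if r: "0 \<le> r" for r
  proof -
    let ?x = "(r, real k)"
    have "r * e \<le> N ?x + w" using ge[OF ray[OF r]] by simp
    also have "\<dots> \<le> N (\<psi> (\<phi> ?x)) + C + w"
      using is_norm_triangle_diff[OF N, of ?x "\<psi> (\<phi> ?x)"] C[OF ray[OF r]]
        is_norm_minus_commute[OF N, of ?x "\<psi> (\<phi> ?x)"] by simp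
    also have "\<dots> \<le> A * h r + B + C + w"
      using AB[OF \<phi>[OF ray[OF r]]] by (simp add: h_def)
    finally show ?thesis using e by (simp add: field_simps)
  qed
  have step: "h (2 * 2 ^ (n - 1) * r) \<le> 2 ^ (n - 1) * h r + (D + 2 * w) / e" if r: "0 \<le> r" for r
  proof -
    let ?x = "(r, real k)"
    let ?y = "(2 ^ n * r, real k)"
    let ?z = "(g_map k ^^ n) (\<phi> ?x)"
    have "(2::real) * 2 ^ (n - 1) = 2 ^ n" using n by (cases n) auto
    then have "h (2 * 2 ^ (n - 1) * r) * e = fst (\<phi> ?y) * e"
      by (simp add: h_def)
    also have "\<dots> \<le> N (\<phi> ?y) + w" using ge[OF \<phi>[OF ray[of "2 ^ n * r"]]] r by simp
    also have "\<dots> \<le> N ?z + D + w"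
      using D[OF ray[OF r]] is_norm_triangle_diff[OF N, of "\<phi> ?y" ?z]
      by (simp add: f_map_funpow_last_ray)
    also have "\<dots> \<le> fst ?z * e + D + 2 * w"
      using le[OF g_map_funpow_in_rays[OF \<phi>[OF ray[OF r]], of n]] by simp
    also have "\<dots> \<le> 2 ^ (n - 1) * h r * e + D + 2 * w"
      using mult_right_mono[OF fst_g_map_funpow_le[OF \<phi>[OF ray[OF r]] n], of e] e
      by (simp add: h_def)
    finally show ?thesis using e by (simp add: field_simps)
  qed
  have "0 \<le> D"
    by (rule order_trans[OF is_norm_nonneg[OF N] D[OF ray[of 0]]]) simp
  then have D': "0 \<le> (D + 2 * w) / e" using e w by simp
  have A': "0 \<le> A / e" using e A by simp
  \<comment> \<open>Here \<open>k \<ge> 1\<close> enters: it forces \<open>n \<ge> 2\<close>.\<close>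
  have "1 \<le> n - 1" using k n by linarith
  then have q: "2 \<le> (2::real) ^ (n - 1)"
    using power_increasing[of 1 "n - 1" "2::real"] by simp
  show False
    by (rule no_linear_lower_bound[where h = h, OF q D' A' step lower])
qed

theorem theorem2p9:
  fixes N :: "real \<times> real \<Rightarrow> real" and k :: nat and X Y :: "(real \<times> real) metric"
  assumes "is_norm N"
    and "k \<ge> 1"
    and "X = norm_metric N (rays k)"
    and "Y = norm_metric N (rays k)"
  shows "bij_betw (f_map k) (mspace X) (mspace X) \<and>
    bij_betw (g_map k) (mspace Y) (mspace Y) \<and>
    (\<forall>n>k.
      \<not> (\<exists>\<phi>. coarse_equivalence X Y \<phi> \<and>
             close_maps (mspace X) Y (\<phi> \<circ> (f_map k ^^ n)) ((g_map k ^^ n) \<circ> \<phi>)) \<and>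
      \<not> coarsely_conjugate X Y (f_map k ^^ n) (g_map k ^^ n))"
proof -
  have "Y = X" using assms by simp
  have no_equiv: "\<not> (\<exists>\<phi>. coarse_equivalence X X \<phi> \<and>
      close_maps (mspace X) X (\<phi> \<circ> (f_map k ^^ n)) ((g_map k ^^ n) \<circ> \<phi>))" if "k < n" for n
    using no_coarse_equivalence[OF assms(1,2) that assms(3)] by blast
  then have "\<not> coarsely_conjugate X X (f_map k ^^ n) (g_map k ^^ n)" if "k < n" for n
    using that unfolding coarsely_conjugate_def by blast
  with no_equiv show ?thesis
    using assms bij_betw_f_map bij_betw_g_map unfolding \<open>Y = X\<close> by simp
qed

end
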